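(* Let $L=L_1\cup\cdots\cup L_\ell$ be an oriented ordered link and let $B$ be an abelian group. For every component signature $\tau\in\{0,1\}^\ell$, the $\operatorname{Conj}(\operatorname{Dih}(B))$-colorings of $L$ with signature $\tau$ are in bijection with \[ \operatorname{Hom}_{\mathbb{Z}}\bigl(A_\tau(L),B\bigr). \] Therefore there is a bijection of sets \[ \operatorname{Hom}_{\mathrm{Qnd}}\bigl(Q(L),\operatorname{Conj}(\operatorname{Dih}(B))\bigr)\cong\bigsqcup_{\tau\in\{0,1\}^\ell}\operatorname{Hom}_{\mathbb{Z}}\bigl(A_\tau(L),B\bigr). \]
   Context: Quandles. A quandle is a set $X$ with a binary operation $\triangleright$ such that $x\triangleright x=x$, each map $x\mapsto x\triangleright y$ is a bijection, and $(x\triangleright y)\triangleright z=(x\triangleright z)\triangleright(y\triangleright z)$. For a group $G$, $\operatorname{Conj}(G)$ is the set $G$ with $x\triangleright y=y^{-1}xy$. $\operatorname{Hom}_{\mathrm{Qnd}}$ denotes the set of quandle homomorphisms, $\operatorname{Hom}_{\mathbb{Z}}$ the set of homomorphisms of abelian groups. Generalized dihedral group. For an abelian group $B$ (written additively), $\operatorname{Dih}(B)=B\rtimes\mathbb{Z}/2\mathbb{Z}$, where the nontrivial element of $\mathbb{Z}/2\mathbb{Z}$ acts on $B$ by $x\mapsto -x$. Elements of $B$ are called rotations (type $0$), and elements outside $B$, i.e. those mapping to the nontrivial element of $\mathbb{Z}/2\mathbb{Z}$, are called reflections (type $1$). Diagram conventions. Let $D$ be a diagram of an oriented ordered link $L=L_1\cup\cdots\cup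 L_\ell$. An arc of $D$ is a maximal piece of the diagram running from one undercrossing to the next; a component with no undercrossings counts as a single arc. Let $m$ be the number of arcs and $k$ the number of crossings. At each crossing let $a$ be the over-arc; of the two under-arcs, the source $b$ is the one lying to the right of the oriented over-arc and the target $c$ is the one lying to its left (so at a positive crossing the source is the incoming under-arc and the target is the outgoing one, and at a negative crossing the roles are reversed). Fundamental quandle and colorings. $Q(L)$ is the quandle presented by the arcs of $D$ as generators with one relation $c=b\triangleright a$ for each crossing. A $T$-coloring of $L$ is a quandle homomorphism $Q(L)\to T$, equivalently an assignment of elements of $T$ to the arcs of $D$ satisfying these relations. A component signature is a vector $\tau=(\tau_1,\ldots,\tau_\ell)\in\{0,1\}^\ell$; a $\operatorname{Conj}(\operatorname{Dih}(B))$-coloring has signature $\tau$ if, for each $j$, all arcs on $L_j$ are colored by elements of type $\tau_j$. Signature module. Given $\tau$, an arc on $L_j$ is said to have type $\tau_j$. Assign a variable $x_i$ to each arc of $D$. At a crossing with over-arc $a$ of type $\delta$ and under-arcs $b$ (source), $c$ (target), both of type $\epsilon$, form the integer linear relation $2\epsilon x_a+(-1)^\delta x_b-x_c=0$ (coefficients are added if some of $a,b,c$ coincide). The matrix $M_\tau(D)\in\operatorname{Mat}_{k\times m}(\mathbb{Z})$ has one row for each crossing, consisting of these coefficients, and $A_\tau(D)=\mathbb{Z}^m/\operatorname{rowspan}_{\mathbb{Z}}(M_\tau(D))$. Its isomorphism class is independent of the diagram $D$ of $L$ and is denoted $A_\tau(L)$. *)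

theory Defs
  imports "HOL-Analysis.Analysis" "HOL-Algebra.Free_Abelian_Groups"
begin

section \<open>Quandles\<close>

record 'a qnd = "'a partial_object" +
  rhd :: "'a \<Rightarrow> 'a \<Rightarrow> 'a"  (infixl \<open>\<rhd>\<index>\<close> 70)

locale quandle =
  fixes X (structure)
  assumes closed: "\<lbrakk>x \<in> carrier X; y \<in> carrier X\<rbrakk> \<Longrightarrow> x \<rhd> y \<in> carrier X"
    and idem: "x \<in> carrier X \<Longrightarrow> x \<rhd> x = x"
    and bij: "y \<in> carrier X \<Longrightarrow> bij_betw (\<lambda>x. x \<rhd> y) (carrier X) (carrier X)"
    and distrib: "\<lbrakk>x \<in> carrier X; y \<in> carrier X; z \<in> carrier X\<rbrakk>
      \<Longrightarrow> (x \<rhd> y) \<rhd> z = (x \<rhd> z) \<rhd> (y \<rhd> z)"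

text \<open>Homomorphisms are extensional functions, so that equal homomorphisms are equal in HOL
  and sets of homomorphisms have the right cardinality.\<close>

definition Hom_Qnd :: "('a, 'm) qnd_scheme \<Rightarrow> ('b, 'n) qnd_scheme \<Rightarrow> ('a \<Rightarrow> 'b) set" where
  "Hom_Qnd X Y = {f \<in> carrier X \<rightarrow>\<^sub>E carrier Y.
     \<forall>x \<in> carrier X. \<forall>y \<in> carrier X. f (x \<rhd>\<^bsub>X\<^esub> y) = f x \<rhd>\<^bsub>Y\<^esub> f y}"

definition Hom_Z :: "('a, 'm) monoid_scheme \<Rightarrow> ('b, 'n) monoid_scheme \<Rightarrow> ('a \<Rightarrow> 'b) set" where
  "Hom_Z A B = hom A B \<inter> extensional (carrier A)"

definition Conj :: "('a, 'm) monoid_scheme \<Rightarrow> 'a qnd" where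
  "Conj G = \<lparr>carrier = carrier G, rhd = (\<lambda>x y. inv\<^bsub>G\<^esub> y \<otimes>\<^bsub>G\<^esub> x \<otimes>\<^bsub>G\<^esub> y)\<rparr>"

lemma (in group) quandle_Conj: "quandle (Conj G)"
proof
  fix y assume "y \<in> carrier (Conj G)"
  then have y: "y \<in> carrier G" by (simp add: Conj_def)
  have *: "y \<otimes> (inv y \<otimes> u) = u" "inv y \<otimes> (y \<otimes> u) = u" if "u \<in> carrier G" for u
    using that y by (simp_all flip: m_assoc)
  show "bij_betw (\<lambda>x. x \<rhd>\<^bsub>Conj G\<^esub> y) (carrier (Conj G)) (carrier (Conj G))"
    by (rule bij_betw_byWitness[where f' = "\<lambda>x. y \<otimes> x \<otimes> inv y"])
       (use y in \<open>auto simp: Conj_def m_assoc *\<close>)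
next
  fix x y z assume "x \<in> carrier (Conj G)" "y \<in> carrier (Conj G)" "z \<in> carrier (Conj G)"
  then have xyz: "x \<in> carrier G" "y \<in> carrier G" "z \<in> carrier G" by (simp_all add: Conj_def)
  have *: "z \<otimes> (inv z \<otimes> u) = u" if "u \<in> carrier G" for u
    using that xyz by (simp flip: m_assoc)
  show "(x \<rhd>\<^bsub>Conj G\<^esub> y) \<rhd>\<^bsub>Conj G\<^esub> z
      = (x \<rhd>\<^bsub>Conj G\<^esub> z) \<rhd>\<^bsub>Conj G\<^esub> (y \<rhd>\<^bsub>Conj G\<^esub> z)"
    using xyz by (simp add: Conj_def m_assoc inv_mult_group *)
qed (auto simp: Conj_def m_assoc inv_solve_left)

subsection \<open>Quandles presented by generators and relations\<close>

text \<open>\<open>Unact s t\<close> stands for the unique \<open>x\<close> with \<open>x \<rhd> t = s\<close>, so that bijectivity of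
  right multiplication becomes equational.\<close>

datatype (gens: 'g) qterm = Gen 'g | Act "'g qterm" "'g qterm" | Unact "'g qterm" "'g qterm"

definition qterms :: "'g set \<Rightarrow> 'g qterm set" where
  "qterms S = {t. gens t \<subseteq> S}"

inductive_set qcong :: "'g set \<Rightarrow> ('g qterm \<times> 'g qterm) set \<Rightarrow> ('g qterm \<times> 'g qterm) set"
  for S R where
  refl: "t \<in> qterms S \<Longrightarrow> (t, t) \<in> qcong S R"
| sym: "(s, t) \<in> qcong S R \<Longrightarrow> (t, s) \<in> qcong S R"
| trans: "\<lbrakk>(s, t) \<in> qcong S R; (t, u) \<in> qcong S R\<rbrakk> \<Longrightarrow> (s, u) \<in> qcong S R"
| act: "\<lbrakk>(s, s') \<in> qcong S R; (t, t') \<in> qcong S R\<rbrakk> \<Longrightarrow> (Act s t, Act s' t') \<in> qcong S R"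
| unact: "\<lbrakk>(s, s') \<in> qcong S R; (t, t') \<in> qcong S R\<rbrakk> \<Longrightarrow> (Unact s t, Unact s' t') \<in> qcong S R"
| rel: "\<lbrakk>(s, t) \<in> R; s \<in> qterms S; t \<in> qterms S\<rbrakk> \<Longrightarrow> (s, t) \<in> qcong S R"
| idem: "t \<in> qterms S \<Longrightarrow> (Act t t, t) \<in> qcong S R"
| act_unact: "\<lbrakk>s \<in> qterms S; t \<in> qterms S\<rbrakk> \<Longrightarrow> (Act (Unact s t) t, s) \<in> qcong S R"
| unact_act: "\<lbrakk>s \<in> qterms S; t \<in> qterms S\<rbrakk> \<Longrightarrow> (Unact (Act s t) t, s) \<in> qcong S R"
| distrib: "\<lbrakk>s \<in> qterms S; t \<in> qterms S; u \<in> qterms S\<rbrakk>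
    \<Longrightarrow> (Act (Act s t) u, Act (Act s u) (Act t u)) \<in> qcong S R"

definition presented_qnd :: "'g set \<Rightarrow> ('g qterm \<times> 'g qterm) set \<Rightarrow> 'g qterm set qnd" where
  "presented_qnd S R = \<lparr>carrier = qterms S // qcong S R,
     rhd = (\<lambda>X Y. \<Union>s\<in>X. \<Union>t\<in>Y. qcong S R `` {Act s t})\<rparr>"

lemma qcong_in_qterms: "(s, t) \<in> qcong S R \<Longrightarrow> s \<in> qterms S \<and> t \<in> qterms S"
  by (induction rule: qcong.induct) (auto simp: qterms_def)

lemma equiv_qcong: "equiv (qterms S) (qcong S R)"
  by (intro equivI refl_onI symI transI)
     (auto dest: qcong_in_qterms intro: qcong.refl qcong.sym qcong.trans)

lemma presented_rhd:
  assumes "s \<in> qterms S" "t \<in> qterms S"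
  shows "(qcong S R `` {s}) \<rhd>\<^bsub>presented_qnd S R\<^esub> (qcong S R `` {t}) = qcong S R `` {Act s t}"
proof -
  have "congruent2 (qcong S R) (qcong S R) (\<lambda>s t. qcong S R `` {Act s t})"
    by (intro congruent2I' equiv_class_eq[OF equiv_qcong] qcong.act)
  from UN_equiv_class2[OF equiv_qcong equiv_qcong this assms]
  show ?thesis by (simp add: presented_qnd_def)
qed

lemma quandle_presented_qnd: "quandle (presented_qnd S R)"
proof -
  let ?E = "qcong S R" and ?Q = "presented_qnd S R"
  have eq: "?E `` {s} = ?E `` {t}" if "(s, t) \<in> ?E" for s t
    using equiv_class_eq[OF equiv_qcong that] .
  have iff: "(s, t) \<in> ?E" if "?E `` {s} = ?E `` {t}" "t \<in> qterms S" for s t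
    using eq_equiv_class[OF that(1) equiv_qcong that(2)] .
  have car: "X \<in> carrier ?Q \<longleftrightarrow> (\<exists>t \<in> qterms S. X = ?E `` {t})" for X
    by (auto simp: presented_qnd_def quotient_def)
  have tm [simp]: "Act s t \<in> qterms S \<longleftrightarrow> s \<in> qterms S \<and> t \<in> qterms S"
      "Unact s t \<in> qterms S \<longleftrightarrow> s \<in> qterms S \<and> t \<in> qterms S" for s t
    by (auto simp: qterms_def)
  show ?thesis
  proof
    fix Y assume "Y \<in> carrier ?Q"
    then obtain t where t: "t \<in> qterms S" "Y = ?E `` {t}" by (auto simp: car)
    show "bij_betw (\<lambda>X. X \<rhd>\<^bsub>?Q\<^esub> Y) (carrier ?Q) (carrier ?Q)"
      unfolding bij_betw_def
    proof
      show "inj_on (\<lambda>X. X \<rhd>\<^bsub>?Q\<^esub> Y) (carrier ?Q)"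
      proof (rule inj_onI)
        fix X X' assume "X \<in> carrier ?Q" "X' \<in> carrier ?Q" "X \<rhd>\<^bsub>?Q\<^esub> Y = X' \<rhd>\<^bsub>?Q\<^esub> Y"
        then obtain s s' where s: "s \<in> qterms S" "X = ?E `` {s}" "s' \<in> qterms S" "X' = ?E `` {s'}"
          and "?E `` {Act s t} = ?E `` {Act s' t}"
          by (auto simp: car t presented_rhd)
        then have "(Act s t, Act s' t) \<in> ?E" using t by (intro iff) auto
        then have "(Unact (Act s t) t, Unact (Act s' t) t) \<in> ?E"
          using t by (intro qcong.unact qcong.refl)
        then have "(s, s') \<in> ?E"
          using s t by (meson qcong.sym qcong.trans qcong.unact_act)
        then show "X = X'" using s eq by simp
      qed
      show "(\<lambda>X. X \<rhd>\<^bsub>?Q\<^esub> Y) ` carrier ?Q = carrier ?Q"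
      proof
        show "(\<lambda>X. X \<rhd>\<^bsub>?Q\<^esub> Y) ` carrier ?Q \<subseteq> carrier ?Q"
          using t by (auto simp: car presented_rhd intro!: bexI[of _ "Act _ t"])
        show "carrier ?Q \<subseteq> (\<lambda>X. X \<rhd>\<^bsub>?Q\<^esub> Y) ` carrier ?Q"
        proof
          fix X assume "X \<in> carrier ?Q"
          then obtain s where s: "s \<in> qterms S" "X = ?E `` {s}" by (auto simp: car)
          have "X = (?E `` {Unact s t}) \<rhd>\<^bsub>?Q\<^esub> Y"
            using s t eq[OF qcong.act_unact[of s S t R]] by (simp add: presented_rhd)
          moreover have "?E `` {Unact s t} \<in> carrier ?Q" using s t by (auto simp: car)
          ultimately show "X \<in> (\<lambda>X. X \<rhd>\<^bsub>?Q\<^esub> Y) ` carrier ?Q" by blast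
        qed
      qed
    qed
  next
    fix X Y assume "X \<in> carrier ?Q" "Y \<in> carrier ?Q"
    then obtain s t where "s \<in> qterms S" "t \<in> qterms S" "X = ?E `` {s}" "Y = ?E `` {t}"
      by (auto simp: car)
    then show "X \<rhd>\<^bsub>?Q\<^esub> Y \<in> carrier ?Q"
      by (auto simp: car presented_rhd intro!: bexI[of _ "Act s t"])
  next
    fix X assume "X \<in> carrier ?Q"
    then show "X \<rhd>\<^bsub>?Q\<^esub> X = X"
      using eq[OF qcong.idem] by (auto simp: car presented_rhd)
  next
    fix X Y Z assume "X \<in> carrier ?Q" "Y \<in> carrier ?Q" "Z \<in> carrier ?Q"
    then obtain s t u where "s \<in> qterms S" "t \<in> qterms S" "u \<in> qterms S"
      "X = ?E `` {s}" "Y = ?E `` {t}" "Z = ?E `` {u}"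
      by (auto simp: car)
    then show "(X \<rhd>\<^bsub>?Q\<^esub> Y) \<rhd>\<^bsub>?Q\<^esub> Z = (X \<rhd>\<^bsub>?Q\<^esub> Z) \<rhd>\<^bsub>?Q\<^esub> (Y \<rhd>\<^bsub>?Q\<^esub> Z)"
      by (simp add: presented_rhd eq qcong.distrib)
  qed
qed

section \<open>Generalized dihedral groups\<close>

definition semidirect_product ::
  "('a, 'm) monoid_scheme \<Rightarrow> ('b, 'n) monoid_scheme \<Rightarrow> ('b \<Rightarrow> 'a \<Rightarrow> 'a) \<Rightarrow> ('a \<times> 'b) monoid" where
  "semidirect_product N H \<phi> = \<lparr>carrier = carrier N \<times> carrier H,
     mult = (\<lambda>(x, g) (y, h). (x \<otimes>\<^bsub>N\<^esub> \<phi> g y, g \<otimes>\<^bsub>H\<^esub> h)),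
     one = (\<one>\<^bsub>N\<^esub>, \<one>\<^bsub>H\<^esub>)\<rparr>"

text \<open>The abelian group \<open>B\<close> is written multiplicatively; the second component of an element
  is its type (0 for rotations, 1 for reflections).\<close>

definition Dih :: "('b, 'm) monoid_scheme \<Rightarrow> ('b \<times> int) monoid" where
  "Dih B = semidirect_product B (integer_mod_group 2) (\<lambda>g x. if g = 0 then x else inv\<^bsub>B\<^esub> x)"

section \<open>Links and their diagrams\<close>

text \<open>A component is a simple closed curve given as an injective 1-periodic map; the parameter
  direction is the orientation and the position in the list is the order. Tameness is not part
  of this definition: a link has a diagram in the sense below only if it is tame.\<close>

type_synonym link = "(real \<Rightarrow> real^3) list"

definition oriented_link :: "link \<Rightarrow> bool" where
  "oriented_link L \<longleftrightarrow>
     (\<forall>j < length L. continuous_on UNIV (L ! j) \<and> (\<forall>t. (L ! j) (t + 1) = (L ! j) t)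
        \<and> inj_on (L ! j) {0..<1}) \<and>
     (\<forall>i < length L. \<forall>j < length L. i \<noteq> j \<longrightarrow> range (L ! i) \<inter> range (L ! j) = {})"

definition ambient_isotopic :: "link \<Rightarrow> link \<Rightarrow> bool" where
  "ambient_isotopic L L' \<longleftrightarrow> length L = length L' \<and>
     (\<exists>h :: real \<times> (real^3) \<Rightarrow> real^3. continuous_on ({0..1} \<times> UNIV) h \<and>
        (\<forall>x. h (0, x) = x) \<and>
        (\<forall>s \<in> {0..1}. \<exists>g. homeomorphism UNIV UNIV (\<lambda>x. h (s, x)) g) \<and>
        (\<forall>j < length L. \<exists>\<phi>. continuous_on UNIV \<phi> \<and> strict_mono \<phi> \<and>
           (\<forall>t. \<phi> (t + 1) = \<phi> t + 1) \<and> (\<forall>t. h (1, (L ! j) t) = (L' ! j) (\<phi> t))))"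

definition proj :: "real^3 \<Rightarrow> real \<times> real" where
  "proj p = (p $ 1, p $ 2)"

text \<open>A crossing is a pair \<open>((i, s), (j, t))\<close>: the strand of component \<open>i\<close> at parameter \<open>s\<close>
  passes over the strand of component \<open>j\<close> at parameter \<open>t\<close>.\<close>

type_synonym crossing = "(nat \<times> real) \<times> (nat \<times> real)"

definition crossings :: "link \<Rightarrow> crossing set" where
  "crossings D = {((i, s), (j, t)). i < length D \<and> j < length D \<and> s \<in> {0..<1} \<and> t \<in> {0..<1} \<and>
     proj ((D ! i) s) = proj ((D ! j) t) \<and> (D ! j) t $ 3 < (D ! i) s $ 3}"

text \<open>The determinant of the projected velocities of the over- and the under-strand. It is
  positive iff the under-strand passes from the right to the left of the oriented over-strand,
  i.e. iff the crossing is positive.\<close>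

fun crossing_det :: "link \<Rightarrow> crossing \<Rightarrow> real" where
  "crossing_det D ((i, s), (j, t)) =
     (let v = vector_derivative (D ! i) (at s); w = vector_derivative (D ! j) (at t)
      in v $ 1 * w $ 2 - v $ 2 * w $ 1)"

text \<open>A diagram is given by a C1 link in general position with respect to the projection; the
  third coordinate records which strand is over. Injectivity in the last clause excludes
  multiple points: a triple point would carry three crossings.\<close>

definition link_diagram :: "link \<Rightarrow> bool" where
  "link_diagram D \<longleftrightarrow> oriented_link D \<and>
     (\<forall>j < length D. (D ! j) C1_differentiable_on UNIV \<and>
        (\<forall>t. proj (vector_derivative (D ! j) (at t)) \<noteq> (0, 0))) \<and>
     finite (crossings D) \<and>
     (\<forall>x \<in> crossings D. crossing_det D x \<noteq> 0) \<and>
     inj_on (\<lambda>((i, s), _). proj ((D ! i) s)) (crossings D)"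

definition diagram_of :: "link \<Rightarrow> link \<Rightarrow> bool" where
  "diagram_of D L \<longleftrightarrow> link_diagram D \<and> ambient_isotopic L D"

text \<open>Arcs are regarded as subsets of the space curve \<open>D\<close> rather than of its projection.
  Removing the undercrossing points cuts a component into arcs, and a component with no
  undercrossing remains one arc.\<close>

definition undercrossing_points :: "link \<Rightarrow> (real^3) set" where
  "undercrossing_points D = (\<lambda>(_, (j, t)). (D ! j) t) ` crossings D"

definition arcs_on :: "link \<Rightarrow> nat \<Rightarrow> (real^3) set set" where
  "arcs_on D j = components (range (D ! j) - undercrossing_points D)"

definition arcs :: "link \<Rightarrow> (real^3) set set" where
  "arcs D = (\<Union>j < length D. arcs_on D j)"

fun over_arc :: "link \<Rightarrow> crossing \<Rightarrow> (real^3) set" where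
  "over_arc D ((i, s), _) = (THE A. A \<in> arcs D \<and> (D ! i) s \<in> A)"

fun incoming_arc :: "link \<Rightarrow> crossing \<Rightarrow> (real^3) set" where
  "incoming_arc D (_, (j, t)) = (THE A. A \<in> arcs D \<and> (\<forall>\<^sub>F u in at_left t. (D ! j) u \<in> A))"

fun outgoing_arc :: "link \<Rightarrow> crossing \<Rightarrow> (real^3) set" where
  "outgoing_arc D (_, (j, t)) = (THE A. A \<in> arcs D \<and> (\<forall>\<^sub>F u in at_right t. (D ! j) u \<in> A))"

definition source_arc :: "link \<Rightarrow> crossing \<Rightarrow> (real^3) set" where
  "source_arc D x = (if crossing_det D x > 0 then incoming_arc D x else outgoing_arc D x)"

definition target_arc :: "link \<Rightarrow> crossing \<Rightarrow> (real^3) set" where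
  "target_arc D x = (if crossing_det D x > 0 then outgoing_arc D x else incoming_arc D x)"

section \<open>Fundamental quandle, colorings and signature modules\<close>

definition quandle_relations :: "link \<Rightarrow> ((real^3) set qterm \<times> (real^3) set qterm) set" where
  "quandle_relations D =
     (\<lambda>x. (Gen (target_arc D x), Act (Gen (source_arc D x)) (Gen (over_arc D x)))) ` crossings D"

definition fundamental_quandle :: "link \<Rightarrow> (real^3) set qterm set qnd" where
  "fundamental_quandle D = presented_qnd (arcs D) (quandle_relations D)"

definition arc_class :: "link \<Rightarrow> (real^3) set \<Rightarrow> (real^3) set qterm set" where
  "arc_class D A = qcong (arcs D) (quandle_relations D) `` {Gen A}"

definition signatures :: "nat \<Rightarrow> nat list set" where
  "signatures l = {\<tau>. length \<tau> = l \<and> set \<tau> \<subseteq> {0, 1}}"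

definition signature_colorings ::
  "link \<Rightarrow> ('b, 'm) monoid_scheme \<Rightarrow> nat list \<Rightarrow> ((real^3) set qterm set \<Rightarrow> 'b \<times> int) set" where
  "signature_colorings D B \<tau> = {f \<in> Hom_Qnd (fundamental_quandle D) (Conj (Dih B)).
     \<forall>j < length D. \<forall>A \<in> arcs_on D j. snd (f (arc_class D A)) = int (\<tau> ! j)}"

text \<open>The row of the matrix at a crossing, as an element of the free abelian group on the arcs;
  \<open>\<tau> ! i\<close> is the type of the over-arc and \<open>\<tau> ! j\<close> the type of both under-arcs.\<close>

fun signature_row :: "link \<Rightarrow> nat list \<Rightarrow> crossing \<Rightarrow> (real^3) set \<Rightarrow>\<^sub>0 int" where
  "signature_row D \<tau> ((i, s), (j, t)) = (let x = ((i, s), (j, t)) in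
     frag_cmul (2 * int (\<tau> ! j)) (frag_of (over_arc D x))
     + frag_cmul ((-1) ^ (\<tau> ! i)) (frag_of (source_arc D x))
     - frag_of (target_arc D x))"

definition signature_module :: "link \<Rightarrow> nat list \<Rightarrow> ((real^3) set \<Rightarrow>\<^sub>0 int) set monoid" where
  "signature_module D \<tau> = (let F = free_Abelian_group (arcs D)
     in F Mod generate F (signature_row D \<tau> ` crossings D))"

end

theory Submission
  imports Defs
begin

text \<open>A coloring of the link is a labelling of the arcs that satisfies one equation per crossing. In
  \<open>Conj (Dih B)\<close> such a label is a pair of an element of \<open>B\<close> and a type, and conjugation does not
  change the type of the conjugated element. Once the types are prescribed, the equation at a
  crossing is therefore an equation in \<open>B\<close> between three labels, and it is linear: conjugating
  an element of type \<open>\<epsilon>\<close> with \<open>B\<close>-part \<open>b\<close> by one of type \<open>\<delta>\<close> with \<open>B\<close>-part \<open>a\<close> yields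
  the \<open>B\<close>-part \<open>b\<close>, \<open>-b\<close>, \<open>b - 2a\<close> or \<open>2a - b\<close> for \<open>(\<epsilon>, \<delta>) = (0,0), (0,1), (1,0), (1,1)\<close>.
  The relation of the signature module asks for \<open>2\<epsilon>a + (-1)\<^sup>\<delta> b\<close>, which differs in the third
  case only. Describing rotations by the negatives of their \<open>B\<close>-parts (\<open>twist\<close>) removes this
  difference and leaves the other three cases as they are (lemma \<open>rhd_Conj_Dih\<close>). So colorings of
  signature \<open>\<tau>\<close> correspond to solutions in \<open>B\<close> of the linear system with matrix \<open>M\<^sub>\<tau>\<close>, and these
  are the homomorphisms from the cokernel \<open>A\<^sub>\<tau>\<close> to \<open>B\<close>. The two outer translations are the
  universal properties of a presented quandle (\<open>bij_betw_Hom_presented\<close>) and of a quotient of a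
  free abelian group (\<open>bij_betw_Hom_free_quotient\<close>).

  For the disjoint union, every coloring must have exactly one signature. Source and target of a
  crossing have the same type, so the type does not change on passing an undercrossing, and
  following a component shows that it is constant there (\<open>arc_labelling_constant\<close>). Since arcs are
  connected components of a space curve with finitely many points removed, this and the fact that
  each crossing determines its three arcs are proved topologically: near each parameter, on either
  side of it, the curve stays on one arc (\<open>arc_at_left\<close>, \<open>arc_at_right\<close>), and the real line is
  connected. Uniqueness of the signature holds because every component carries an arc.\<close>

section \<open>Homomorphisms out of a presented quandle\<close>

primrec qterm_eval :: "('a, 'm) qnd_scheme \<Rightarrow> ('g \<Rightarrow> 'a) \<Rightarrow> 'g qterm \<Rightarrow> 'a" where
  "qterm_eval X f (Gen g) = f g"
| "qterm_eval X f (Act s t) = qterm_eval X f s \<rhd>\<^bsub>X\<^esub> qterm_eval X f t"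
| "qterm_eval X f (Unact s t) =
     inv_into (carrier X) (\<lambda>x. x \<rhd>\<^bsub>X\<^esub> qterm_eval X f t) (qterm_eval X f s)"

lemma qterms_simps [simp]:
  "Gen g \<in> qterms S \<longleftrightarrow> g \<in> S"
  "Act s t \<in> qterms S \<longleftrightarrow> s \<in> qterms S \<and> t \<in> qterms S"
  "Unact s t \<in> qterms S \<longleftrightarrow> s \<in> qterms S \<and> t \<in> qterms S"
  by (auto simp: qterms_def)

lemma carrier_presented_qnd:
  "carrier (presented_qnd S R) = (\<lambda>t. qcong S R `` {t}) ` qterms S"
  by (auto simp: presented_qnd_def quotient_def)

context quandle
begin

lemma unact:
  assumes "x \<in> carrier X" "y \<in> carrier X"
  shows unact_closed: "inv_into (carrier X) (\<lambda>x. x \<rhd> y) x \<in> carrier X"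
    and act_inv_into: "inv_into (carrier X) (\<lambda>x. x \<rhd> y) x \<rhd> y = x"
    and inv_into_act: "inv_into (carrier X) (\<lambda>x. x \<rhd> y) (x \<rhd> y) = x"
  using bij[OF assms(2)] assms(1)
  by (auto simp: bij_betw_def inv_into_into inv_into_f_f[of "\<lambda>x. x \<rhd> y"]
      f_inv_into_f[of x "\<lambda>x. x \<rhd> y"])

lemma qterm_eval_closed:
  assumes "f \<in> S \<rightarrow> carrier X" "t \<in> qterms S"
  shows "qterm_eval X f t \<in> carrier X"
  using assms(2) by (induction t) (use assms(1) in \<open>auto intro: closed unact_closed\<close>)

text \<open>The generating rules of \<open>qcong\<close> are the quandle axioms, which hold in \<open>X\<close>, and the relations \<open>R\<close>,
  which hold by assumption; so evaluation is well defined on congruence classes.\<close>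

lemma qterm_eval_qcong:
  assumes "(s, t) \<in> qcong S R" and f: "f \<in> S \<rightarrow> carrier X"
    and R: "\<forall>(s, t) \<in> R. qterm_eval X f s = qterm_eval X f t"
  shows "qterm_eval X f s = qterm_eval X f t"
  using assms(1)
proof (induction rule: qcong.induct)
  case (rel s t)
  then show ?case using R by auto
qed (auto simp: qterm_eval_closed[OF f] idem act_inv_into inv_into_act distrib)

text \<open>A homomorphism is determined by its values on generators. It preserves the inverse operation
  \<open>Unact\<close> as well, because \<open>Unact s t\<close> is the only solution \<open>x\<close> of \<open>x \<rhd> t = s\<close> in either quandle.\<close>

lemma Hom_presented_eval:
  assumes h: "h \<in> Hom_Qnd (presented_qnd S R) X" and "t \<in> qterms S"
  shows "h (qcong S R `` {t}) = qterm_eval X (\<lambda>g \<in> S. h (qcong S R `` {Gen g})) t"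
  using assms(2)
proof (induction t)
  case (Act s t)
  then have "h (qcong S R `` {Act s t}) = h (qcong S R `` {s}) \<rhd> h (qcong S R `` {t})"
    using h by (auto simp: Hom_Qnd_def carrier_presented_qnd simp flip: presented_rhd)
  with Act show ?case by simp
next
  case (Unact s t)
  let ?c = "\<lambda>t. qcong S R `` {t}"
  have st: "s \<in> qterms S" "t \<in> qterms S" using Unact.prems by auto
  have hc: "h (?c u) \<in> carrier X" if "u \<in> qterms S" for u
    using h that by (auto simp: Hom_Qnd_def carrier_presented_qnd)
  have "?c (Act (Unact s t) t) = ?c s"
    using st by (intro equiv_class_eq[OF equiv_qcong] qcong.act_unact)
  moreover have "h (?c (Act (Unact s t) t)) = h (?c (Unact s t)) \<rhd> h (?c t)"
    using h st by (auto simp: Hom_Qnd_def carrier_presented_qnd simp flip: presented_rhd)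
  ultimately have "h (?c s) = h (?c (Unact s t)) \<rhd> h (?c t)" by simp
  then have "inv_into (carrier X) (\<lambda>x. x \<rhd> h (?c t)) (h (?c s)) = h (?c (Unact s t))"
    using st hc by (simp add: inv_into_act)
  with Unact show ?case by simp
qed auto

text \<open>The universal property of the presented quandle. A map on generators that satisfies the relations
  extends by evaluating any representative of a class.\<close>

lemma bij_betw_Hom_presented:
  assumes R: "R \<subseteq> qterms S \<times> qterms S"
  shows "bij_betw (\<lambda>h. \<lambda>g \<in> S. h (qcong S R `` {Gen g}))
    (Hom_Qnd (presented_qnd S R) X)
    {f \<in> S \<rightarrow>\<^sub>E carrier X. \<forall>(s, t) \<in> R. qterm_eval X f s = qterm_eval X f t}"
    (is "bij_betw ?\<Phi> ?H ?F")
proof (rule bij_betw_imageI)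
  let ?c = "\<lambda>t. qcong S R `` {t}"
  show "inj_on ?\<Phi> ?H"
  proof (rule inj_onI)
    fix h h' assume hh': "h \<in> ?H" "h' \<in> ?H" and eq: "?\<Phi> h = ?\<Phi> h'"
    have "h (?c t) = h' (?c t)" if "t \<in> qterms S" for t
      using that hh'[THEN Hom_presented_eval] eq by simp
    then show "h = h'"
      using hh'
      by (intro extensionalityI[of h "carrier (presented_qnd S R)" h'])
         (auto simp: Hom_Qnd_def PiE_def carrier_presented_qnd)
  qed
  show "?\<Phi> ` ?H = ?F"
  proof (intro equalityI subsetI)
    fix f assume "f \<in> ?\<Phi> ` ?H"
    then obtain h where h: "h \<in> ?H" "f = ?\<Phi> h" by blast
    have "qterm_eval X f s = qterm_eval X f t" if "(s, t) \<in> R" for s t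
    proof -
      have "s \<in> qterms S" "t \<in> qterms S" using that R by auto
      then show ?thesis
        using that equiv_class_eq[OF equiv_qcong qcong.rel[of s t R S]]
        by (simp add: h(2) flip: Hom_presented_eval[OF h(1)])
    qed
    then show "f \<in> ?F"
      using h by (auto simp: Hom_Qnd_def carrier_presented_qnd)
  next
    fix f assume f: "f \<in> ?F"
    then have fS: "f \<in> S \<rightarrow> carrier X" by auto
    define h where "h = (\<lambda>C \<in> carrier (presented_qnd S R). qterm_eval X f (SOME t. t \<in> C))"
    have h: "h (?c t) = qterm_eval X f t" if "t \<in> qterms S" for t
    proof -
      have "t \<in> ?c t" using that by (auto intro: qcong.refl)
      then have "(t, SOME u. u \<in> ?c t) \<in> qcong S R"
        by (metis Image_singleton_iff someI)
      then have "qterm_eval X f t = qterm_eval X f (SOME u. u \<in> ?c t)"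
        using f by (intro qterm_eval_qcong) auto
      then show ?thesis using that by (auto simp: h_def carrier_presented_qnd)
    qed
    have "h \<in> ?H"
      using h qterm_eval_closed[OF fS]
      by (auto simp: Hom_Qnd_def carrier_presented_qnd presented_rhd)
         (auto simp: h_def carrier_presented_qnd)
    moreover have "f = ?\<Phi> h"
      using f h by (auto simp: fun_eq_iff PiE_def extensional_def)
    ultimately show "f \<in> ?\<Phi> ` ?H" by blast
  qed
qed

end

section \<open>Homomorphisms out of a quotient of a free abelian group\<close>

text \<open>The universal property of an abelian group given by generators and relations. A family \<open>x\<close> extends
  to exactly one homomorphism \<open>k\<close> on the free group, and \<open>k\<close> factors through the quotient iff it kills
  the relators. Speaking of \<open>k\<close> avoids writing the linear extension as a finite product.\<close>

lemma (in comm_group) bij_betw_Hom_free_quotient: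
  fixes S :: "'c set"
  assumes R: "R \<subseteq> carrier (free_Abelian_group S)"
  defines "N \<equiv> generate (free_Abelian_group S) R"
  shows "bij_betw (\<lambda>h. \<lambda>g \<in> S. h (N #>\<^bsub>free_Abelian_group S\<^esub> frag_of g))
    (Hom_Z (free_Abelian_group S Mod N) G)
    {x \<in> S \<rightarrow>\<^sub>E carrier G. \<exists>k \<in> hom (free_Abelian_group S) G.
       (\<forall>g \<in> S. k (frag_of g) = x g) \<and> (\<forall>r \<in> R. k r = \<one>)}"
    (is "bij_betw ?\<Phi> ?H ?X")
proof (rule bij_betw_imageI)
  let ?F = "free_Abelian_group S"
  let ?c = "\<lambda>x. N #>\<^bsub>?F\<^esub> x"
  interpret F: comm_group ?F by (rule abelian_free_Abelian_group)
  have N: "N \<lhd> ?F"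
    using R by (simp add: N_def F.generate_is_subgroup F.normal_iff_subgroup)
  interpret N: normal N ?F by (rule N)
  have ghom: "group_hom ?F G k" if "k \<in> hom ?F G" for k
    using that by unfold_locales
  have hom_unique: "k c = k' c"
    if "k \<in> hom ?F G" "k' \<in> hom ?F G" "\<forall>g \<in> S. k (frag_of g) = k' (frag_of g)"
      "c \<in> carrier ?F" for k k' c
  proof -
    interpret k: group_hom ?F G k using ghom that by blast
    interpret k': group_hom ?F G k' using ghom that by blast
    have "Poly_Mapping.keys c \<subseteq> S" using that by simp
    then show ?thesis
    proof (induction rule: free_Abelian_group_induct[consumes 1])
      case 1
      then show ?case using k.hom_one k'.hom_one by simp
    next
      case (2 a b)
      have *: "a - b = a \<otimes>\<^bsub>?F\<^esub> inv\<^bsub>?F\<^esub> b" using 2 by simp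
      have "a \<in> carrier ?F" "b \<in> carrier ?F" using 2 by auto
      then show ?case
        unfolding * using 2 k.hom_mult[of a "inv\<^bsub>?F\<^esub> b"] k'.hom_mult[of a "inv\<^bsub>?F\<^esub> b"]
        by (simp del: mult_free_Abelian_group inv_free_Abelian_group carrier_free_Abelian_group_iff)
    next
      case (3 a)
      then show ?case using that by auto
    qed
  qed
  have lift: "(\<lambda>c. h (?c c)) \<in> hom ?F G" if "h \<in> ?H" for h
    using Group.hom_compose[OF N.r_coset_hom_Mod, of h G] that by (simp add: Hom_Z_def comp_def)
  show "inj_on ?\<Phi> ?H"
  proof (rule inj_onI)
    fix h h' assume hh': "h \<in> ?H" "h' \<in> ?H" and eq: "?\<Phi> h = ?\<Phi> h'"
    have "h (?c (frag_of g)) = h' (?c (frag_of g))" if "g \<in> S" for g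
      using fun_cong[OF eq, of g] that by simp
    then have "h (?c c) = h' (?c c)" if "c \<in> carrier ?F" for c
      using hom_unique[OF lift lift] hh' that by blast
    then show "h = h'"
      using hh' by (intro extensionalityI[of h "carrier (?F Mod N)" h'])
        (auto simp: Hom_Z_def carrier_FactGroup)
  qed
  show "?\<Phi> ` ?H = ?X"
  proof (intro equalityI subsetI)
    fix x assume "x \<in> ?\<Phi> ` ?H"
    then obtain h where h: "h \<in> ?H" "x = ?\<Phi> h" by blast
    interpret h: group_hom "?F Mod N" G h
      using h N.factorgroup_is_group by (auto simp: Hom_Z_def group_hom_def group_hom_axioms_def)
    have "h (?c r) = \<one>" if "r \<in> R" for r
    proof -
      have "r \<in> N" using that by (auto simp: N_def intro: generate.incl)
      then have "?c r = N"
        by (simp add: F.coset_join2 N.subset[THEN subsetD] N.is_subgroup del: carrier_free_Abelian_group_iff)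
      then show ?thesis using h.hom_one by simp
    qed
    moreover have "h (?c (frag_of g)) \<in> carrier G" if "g \<in> S" for g
      using that by (auto simp: carrier_FactGroup)
    ultimately show "x \<in> ?X"
      using lift[OF h(1)] by (auto simp: h(2) intro!: bexI[of _ "\<lambda>c. h (?c c)"])
  next
    fix x assume x: "x \<in> ?X"
    then obtain k where k: "k \<in> hom ?F G" "\<forall>g \<in> S. k (frag_of g) = x g" "\<forall>r \<in> R. k r = \<one>"
      by auto
    interpret k: group_hom ?F G k using ghom k by blast
    have "N \<subseteq> kernel ?F G k"
      unfolding N_def
    proof (rule F.generate_subgroup_incl[OF _ k.subgroup_kernel])
      show "R \<subseteq> kernel ?F G k"
        using R k by (auto simp: kernel_def simp del: carrier_free_Abelian_group_iff)
    qed
    then obtain h where h: "h \<in> hom (?F Mod N) G" "\<And>c. c \<in> carrier ?F \<Longrightarrow> h (?c c) = k c"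
      using k.FactGroup_universal_kernel[OF N] by blast
    let ?h = "restrict h (carrier (?F Mod N))"
    have "?h \<in> ?H"
      using h(1) group.is_monoid[OF N.factorgroup_is_group]
      by (auto simp: Hom_Z_def hom_def monoid.m_closed simp del: mult_FactGroup)
    moreover have "x = ?\<Phi> ?h"
      using x k h(2) by (auto simp: fun_eq_iff PiE_def extensional_def carrier_FactGroup)
    ultimately show "x \<in> ?\<Phi> ` ?H" by blast
  qed
qed

section \<open>Generalized dihedral groups\<close>

lemma carrier_Dih: "carrier (Dih B) = carrier B \<times> {0, 1}"
  by (auto simp: Dih_def semidirect_product_def carrier_integer_mod_group)

lemma mult_Dih:
  "(x, g) \<otimes>\<^bsub>Dih B\<^esub> (y, h) = (x \<otimes>\<^bsub>B\<^esub> (if g = 0 then y else inv\<^bsub>B\<^esub> y), (g + h) mod 2)"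
  by (simp add: Dih_def semidirect_product_def)

lemma one_Dih: "\<one>\<^bsub>Dih B\<^esub> = (\<one>\<^bsub>B\<^esub>, 0)"
  by (simp add: Dih_def semidirect_product_def)

context comm_group
begin

lemma group_Dih: "group (Dih G)"
proof (rule groupI)
  fix x y z assume "x \<in> carrier (Dih G)" "y \<in> carrier (Dih G)" "z \<in> carrier (Dih G)"
  then show "x \<otimes>\<^bsub>Dih G\<^esub> y \<otimes>\<^bsub>Dih G\<^esub> z = x \<otimes>\<^bsub>Dih G\<^esub> (y \<otimes>\<^bsub>Dih G\<^esub> z)"
    by (auto simp: carrier_Dih mult_Dih m_assoc inv_mult)
next
  fix x assume "x \<in> carrier (Dih G)"
  then have "(if snd x = 0 then inv (fst x) else fst x, snd x) \<otimes>\<^bsub>Dih G\<^esub> x = \<one>\<^bsub>Dih G\<^esub>"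
    "(if snd x = 0 then inv (fst x) else fst x, snd x) \<in> carrier (Dih G)"
    by (auto simp: carrier_Dih mult_Dih one_Dih)
  then show "\<exists>y \<in> carrier (Dih G). y \<otimes>\<^bsub>Dih G\<^esub> x = \<one>\<^bsub>Dih G\<^esub>" by blast
qed (auto simp: carrier_Dih mult_Dih one_Dih)

lemma inv_Dih:
  assumes "a \<in> carrier G" "d \<in> {0, 1}"
  shows "inv\<^bsub>Dih G\<^esub> (a, d) = (if d = 0 then inv a else a, d)"
  by (rule group.inv_equality[OF group_Dih]) (use assms in \<open>auto simp: carrier_Dih mult_Dih one_Dih\<close>)

lemma snd_rhd_Conj_Dih:
  assumes "x \<in> carrier (Dih G)" "y \<in> carrier (Dih G)"
  shows "snd (x \<rhd>\<^bsub>Conj (Dih G)\<^esub> y) = snd x"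
  using assms by (auto simp: Conj_def carrier_Dih inv_Dih mult_Dih)

text \<open>The \<open>B\<close>-coordinate in which conjugation in the generalized dihedral group takes the form of the
  relations of the signature module: rotations, of type 0, are recorded by their inverses.\<close>

definition twist :: "nat \<Rightarrow> 'a \<Rightarrow> 'a" where
  "twist e b = (if e = 0 then inv b else b)"

lemma twist_closed [simp]: "b \<in> carrier G \<Longrightarrow> twist e b \<in> carrier G"
  and twist_twist [simp]: "b \<in> carrier G \<Longrightarrow> twist e (twist e b) = b"
  by (simp_all add: twist_def)

text \<open>Conjugating the reflection \<open>b\<close> by the rotation \<open>a\<close> multiplies \<open>b\<close> by the inverse square of \<open>a\<close>.
  The inversion of rotations by \<open>twist\<close> turns this into the square itself, which makes one formula
  valid for all four combinations of types.\<close>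

lemma rhd_Conj_Dih:
  assumes "a \<in> carrier G" "b \<in> carrier G" "d \<in> {0, 1}" "e \<in> {0, 1}"
  shows "(twist e b, int e) \<rhd>\<^bsub>Conj (Dih G)\<^esub> (twist d a, int d)
    = (twist e (a [^] (2 * int e) \<otimes> b [^] ((-1) ^ d :: int)), int e)"
proof -
  have sq: "a [^] (2::int) = a \<otimes> a" using assms int_pow_mult[of a 1 1] by simp
  have neg: "b [^] (-1::int) = inv b" using assms int_pow_neg[of b 1] by simp
  have cancel: "a \<otimes> (b \<otimes> inv a) = b"
    using assms by (simp add: m_lcomm[of a b])
  show ?thesis using assms
    by (auto simp: Conj_def inv_Dih mult_Dih twist_def sq neg inv_mult m_ac cancel)
qed

end

section \<open>Arcs of a diagram\<close>

locale diagram =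
  fixes D :: link
  assumes link_diagram: "link_diagram D"
begin

lemma
  assumes "j < length D"
  shows continuous_curve: "continuous_on UNIV (D ! j)"
    and curve_periodic: "(D ! j) (t + 1) = (D ! j) t"
    and inj_on_curve: "inj_on (D ! j) {0..<1}"
  using link_diagram assms by (auto simp: link_diagram_def oriented_link_def)

lemma curve_frac: "j < length D \<Longrightarrow> (D ! j) (frac t) = (D ! j) t"
proof -
  assume j: "j < length D"
  interpret periodic_fun_simple' "D ! j"
    using curve_periodic[OF j] by unfold_locales
  show ?thesis using minus_of_int[of t "\<lfloor>t\<rfloor>"] by (simp add: frac_def)
qed

lemma curves_eq_iff:
  assumes "i < length D" "j < length D"
  shows "(D ! i) s = (D ! j) t \<longleftrightarrow> i = j \<and> frac s = frac t"
proof
  assume eq: "(D ! i) s = (D ! j) t"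
  then have "range (D ! i) \<inter> range (D ! j) \<noteq> {}" by (metis disjoint_iff rangeI)
  then have ij: "i = j"
    using link_diagram assms unfolding link_diagram_def oriented_link_def by blast
  moreover have "frac s = frac t"
    using eq assms ij
    by (intro inj_onD[OF inj_on_curve[of j]]) (auto simp: curve_frac frac_lt_1)
  ultimately show "i = j \<and> frac s = frac t" by simp
qed (metis assms curve_frac)

lemma crossing_bounds:
  assumes "((i, s), (j, t)) \<in> crossings D"
  shows "i < length D" "j < length D" "0 \<le> s" "s < 1" "0 \<le> t" "t < 1"
  using assms by (auto simp: crossings_def)

lemma finite_undercrossing_points: "finite (undercrossing_points D)"
  using link_diagram by (simp add: link_diagram_def undercrossing_points_def)

text \<open>If the strand at \<open>s\<close> passed below a third strand, two distinct crossings would lie over the same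
  point of the plane, which general position excludes.\<close>

lemma over_point_not_undercrossing:
  assumes x: "((i, s), (j, t)) \<in> crossings D"
  shows "(D ! i) s \<notin> undercrossing_points D"
proof
  assume "(D ! i) s \<in> undercrossing_points D"
  then obtain i' s' j' t' where x': "((i', s'), (j', t')) \<in> crossings D" "(D ! i) s = (D ! j') t'"
    by (auto simp: undercrossing_points_def)
  have "inj_on (\<lambda>((i, s), _). proj ((D ! i) s)) (crossings D)"
    using link_diagram by (simp add: link_diagram_def)
  moreover have "proj ((D ! i') s') = proj ((D ! i) s)"
    using x' by (auto simp: crossings_def)
  ultimately have "((i', s'), (j', t')) = ((i, s), (j, t))"
    using inj_onD[of "\<lambda>((i, s), _). proj ((D ! i) s)" "crossings D"
        "((i', s'), (j', t'))" "((i, s), (j, t))"] x x'(1)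
    by simp
  then show False using x x'(2) by (auto simp: crossings_def)
qed

text \<open>There are finitely many undercrossing points, and the one at \<open>u\<close>, if any, is not met again within
  one period. Hence undercrossing parameters are isolated.\<close>

lemma eventually_not_undercrossing:
  assumes j: "j < length D"
  shows "\<forall>\<^sub>F v in at u. (D ! j) v \<notin> undercrossing_points D"
proof -
  let ?U = "undercrossing_points D - {(D ! j) u}"
  have "\<forall>\<^sub>F v in at u. (D ! j) v \<notin> ?U"
  proof (rule eventually_at_topological[THEN iffD2], intro exI conjI)
    have "closed ?U" using finite_undercrossing_points by (intro finite_imp_closed) auto
    then show "open ((D ! j) -` (- ?U))"
      by (intro open_vimage continuous_curve[OF j]) (simp only: open_Compl)
  qed auto
  moreover have "\<forall>\<^sub>F v in at u. (D ! j) v \<noteq> (D ! j) u"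
    unfolding eventually_at
    \<comment> \<open>the radius is the period\<close>
  proof (intro exI[of _ 1] conjI ballI impI)
    fix v assume v: "v \<noteq> u \<and> dist v u < 1"
    show "(D ! j) v \<noteq> (D ! j) u"
    proof
      assume "(D ! j) v = (D ! j) u"
      then have "frac v = frac u" using j curves_eq_iff by blast
      then have "v - u = of_int (\<lfloor>v\<rfloor> - \<lfloor>u\<rfloor>)" by (simp add: frac_def)
      moreover have "\<bar>v - u\<bar> < 1" "v - u \<noteq> 0" using v by (auto simp: dist_real_def)
      ultimately show False by (metis abs_eq_0 of_int_0 of_int_abs of_int_less_1_iff zabs_less_one_iff)
    qed
  qed simp
  ultimately show ?thesis by eventually_elim auto
qed

lemma arc_over_connected_set:
  assumes "j < length D" "connected S" "S \<noteq> {}" "(D ! j) ` S \<inter> undercrossing_points D = {}"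
  shows "\<exists>A \<in> arcs_on D j. (D ! j) ` S \<subseteq> A"
proof -
  have "connected ((D ! j) ` S)"
    using continuous_curve[OF assms(1)] assms(2)
    by (intro connected_continuous_image) (auto intro: continuous_on_subset)
  moreover have "(D ! j) ` S \<subseteq> range (D ! j) - undercrossing_points D" using assms(4) by blast
  ultimately show ?thesis
    using exists_component_superset[of "(D ! j) ` S"] assms(3) unfolding arcs_on_def by blast
qed

text \<open>A one-sided neighbourhood of any parameter, and a full neighbourhood of a parameter that is not an
  undercrossing, is mapped to a connected set without undercrossing points, hence into one arc.\<close>

lemma
  assumes j: "j < length D"
  shows arc_at_left: "\<exists>A \<in> arcs_on D j. \<forall>\<^sub>F v in at_left u. (D ! j) v \<in> A"
    and arc_at_right: "\<exists>A \<in> arcs_on D j. \<forall>\<^sub>F v in at_right u. (D ! j) v \<in> A"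
    and arc_at: "(D ! j) u \<notin> undercrossing_points D \<Longrightarrow>
      \<exists>A \<in> arcs_on D j. (D ! j) u \<in> A \<and> (\<forall>\<^sub>F v in at u. (D ! j) v \<in> A)"
proof -
  obtain d where d: "d > 0" "\<And>v. v \<noteq> u \<Longrightarrow> dist v u < d \<Longrightarrow> (D ! j) v \<notin> undercrossing_points D"
    using eventually_not_undercrossing[OF j, of u] unfolding eventually_at by auto
  obtain A where A: "A \<in> arcs_on D j" "(D ! j) ` {u - d<..<u} \<subseteq> A"
    using arc_over_connected_set[OF j, of "{u - d<..<u}"] d by (force simp: dist_real_def)
  have "\<forall>\<^sub>F v in at_left u. v \<in> {u - d<..<u}"
    using d(1) by (intro eventually_at_leftI[of "u - d"]) auto
  then have "\<forall>\<^sub>F v in at_left u. (D ! j) v \<in> A"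
    by (rule eventually_mono) (use A in auto)
  then show "\<exists>A \<in> arcs_on D j. \<forall>\<^sub>F v in at_left u. (D ! j) v \<in> A"
    using A by blast
next
  obtain d where d: "d > 0" "\<And>v. v \<noteq> u \<Longrightarrow> dist v u < d \<Longrightarrow> (D ! j) v \<notin> undercrossing_points D"
    using eventually_not_undercrossing[OF j, of u] unfolding eventually_at by auto
  obtain A where A: "A \<in> arcs_on D j" "(D ! j) ` {u<..<u + d} \<subseteq> A"
    using arc_over_connected_set[OF j, of "{u<..<u + d}"] d by (force simp: dist_real_def)
  have "\<forall>\<^sub>F v in at_right u. v \<in> {u<..<u + d}"
    using d(1) by (intro eventually_at_rightI[of _ "u + d"]) auto
  then have "\<forall>\<^sub>F v in at_right u. (D ! j) v \<in> A"
    by (rule eventually_mono) (use A in auto)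
  then show "\<exists>A \<in> arcs_on D j. \<forall>\<^sub>F v in at_right u. (D ! j) v \<in> A"
    using A by blast
next
  obtain d where d: "d > 0" "\<And>v. v \<noteq> u \<Longrightarrow> dist v u < d \<Longrightarrow> (D ! j) v \<notin> undercrossing_points D"
    using eventually_not_undercrossing[OF j, of u] unfolding eventually_at by auto
  assume u: "(D ! j) u \<notin> undercrossing_points D"
  then have "(D ! j) v \<notin> undercrossing_points D" if "v \<in> ball u d" for v
    using d(2)[of v] that by (cases "v = u") (simp_all add: dist_commute)
  then obtain A where A: "A \<in> arcs_on D j" "(D ! j) ` ball u d \<subseteq> A"
    using arc_over_connected_set[OF j, of "ball u d"] d(1) by (auto simp: disjoint_iff simp del: mem_ball)
  have "\<forall>\<^sub>F v in at u. v \<in> ball u d"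
    using d(1) by (intro eventually_at_in_open') auto
  then have "\<forall>\<^sub>F v in at u. (D ! j) v \<in> A"
    by (rule eventually_mono) (use A in auto)
  moreover have "(D ! j) u \<in> A" using A d(1) by (simp add: image_subset_iff)
  ultimately show "\<exists>A \<in> arcs_on D j. (D ! j) u \<in> A \<and> (\<forall>\<^sub>F v in at u. (D ! j) v \<in> A)"
    using A by blast
qed

lemma arc_subset_range: "A \<in> arcs_on D j \<Longrightarrow> A \<subseteq> range (D ! j) - undercrossing_points D"
  unfolding arcs_on_def by (rule in_components_subset)

lemma arcs_disjoint:
  assumes "i < length D" "j < length D" "A \<in> arcs_on D i" "A' \<in> arcs_on D j" "p \<in> A" "p \<in> A'"
  shows "i = j" "A = A'"
proof -
  obtain s t where "p = (D ! i) s" "p = (D ! j) t"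
    using assms arc_subset_range by blast
  then show ij: "i = j" using curves_eq_iff assms by metis
  show "A = A'"
    using assms components_nonoverlap[of A "range (D ! j) - undercrossing_points D" A']
    unfolding ij arcs_on_def by blast
qed

lemma arc_nonempty: "A \<in> arcs_on D j \<Longrightarrow> A \<noteq> {}"
  unfolding arcs_on_def by (rule in_components_nonempty)

lemma arcs_on_subset_arcs: "j < length D \<Longrightarrow> arcs_on D j \<subseteq> arcs D"
  by (auto simp: arcs_def)

lemma arcs_on_nonempty: "j < length D \<Longrightarrow> arcs_on D j \<noteq> {}"
  using arc_at_left by blast

text \<open>The arcs at a crossing are defined as the unique arc that contains the curve eventually along a
  filter: the one-sided neighbourhoods for the under-arcs and a principal filter for the over-arc.
  Any arc with this property is unique because distinct arcs are disjoint.\<close>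

lemma the_arc:
  assumes "j < length D" "F \<noteq> bot" "A \<in> arcs_on D j" "\<forall>\<^sub>F v in F. (D ! j) v \<in> A"
  shows "(THE A. A \<in> arcs D \<and> (\<forall>\<^sub>F v in F. (D ! j) v \<in> A)) = A"
proof (rule the_equality)
  fix A' assume A': "A' \<in> arcs D \<and> (\<forall>\<^sub>F v in F. (D ! j) v \<in> A')"
  then obtain i where i: "i < length D" "A' \<in> arcs_on D i" by (auto simp: arcs_def)
  have "\<forall>\<^sub>F v in F. (D ! j) v \<in> A \<and> (D ! j) v \<in> A'"
    using A' assms by (simp add: eventually_conj)
  then obtain v where "(D ! j) v \<in> A" "(D ! j) v \<in> A'"
    using eventually_happens' assms(2) by blast
  then show "A' = A" using arcs_disjoint i assms by blast
qed (use assms arcs_on_subset_arcs in blast)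

context
  fixes i j s t assumes x: "((i, s), (j, t)) \<in> crossings D"
begin

lemma over_arc: "over_arc D ((i, s), (j, t)) \<in> arcs_on D i"
proof -
  have i: "i < length D" using crossing_bounds x by blast
  obtain A where A: "A \<in> arcs_on D i" "(D ! i) s \<in> A"
    using arc_at[OF i over_point_not_undercrossing[OF x]] by blast
  have "over_arc D ((i, s), (j, t)) = A"
    using the_arc[OF i, of "principal {s}" A] A by (simp add: eventually_principal principal_eq_bot_iff)
  then show ?thesis using A by simp
qed

lemma incoming_arc: "incoming_arc D ((i, s), (j, t)) \<in> arcs_on D j"
    "\<forall>\<^sub>F v in at_left t. (D ! j) v \<in> incoming_arc D ((i, s), (j, t))"
  and outgoing_arc: "outgoing_arc D ((i, s), (j, t)) \<in> arcs_on D j"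
    "\<forall>\<^sub>F v in at_right t. (D ! j) v \<in> outgoing_arc D ((i, s), (j, t))"
proof -
  have j: "j < length D" using crossing_bounds x by blast
  obtain A where A: "A \<in> arcs_on D j" "\<forall>\<^sub>F v in at_left t. (D ! j) v \<in> A"
    using arc_at_left[OF j] by blast
  then have "incoming_arc D ((i, s), (j, t)) = A"
    using the_arc[OF j, of "at_left t" A] by simp
  then show "incoming_arc D ((i, s), (j, t)) \<in> arcs_on D j"
    "\<forall>\<^sub>F v in at_left t. (D ! j) v \<in> incoming_arc D ((i, s), (j, t))"
    using A by simp_all
  obtain A where A: "A \<in> arcs_on D j" "\<forall>\<^sub>F v in at_right t. (D ! j) v \<in> A"
    using arc_at_right[OF j] by blast
  then have "outgoing_arc D ((i, s), (j, t)) = A"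
    using the_arc[OF j, of "at_right t" A] by simp
  then show "outgoing_arc D ((i, s), (j, t)) \<in> arcs_on D j"
    "\<forall>\<^sub>F v in at_right t. (D ! j) v \<in> outgoing_arc D ((i, s), (j, t))"
    using A by simp_all
qed

lemma source_target_arc:
  "source_arc D ((i, s), (j, t)) \<in> arcs_on D j" "target_arc D ((i, s), (j, t)) \<in> arcs_on D j"
  using incoming_arc outgoing_arc unfolding source_arc_def target_arc_def by simp_all

end

text \<open>Crossings name parameters in a fundamental period; this transports one-sided germs of the
  curve from there to any other parameter of the same point.\<close>

lemma eventually_curve_frac:
  assumes j: "j < length D"
  shows "\<forall>\<^sub>F v in at_left (frac u). (D ! j) v \<in> A \<Longrightarrow> \<forall>\<^sub>F v in at_left u. (D ! j) v \<in> A"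
    and "\<forall>\<^sub>F v in at_right (frac u). (D ! j) v \<in> A \<Longrightarrow> \<forall>\<^sub>F v in at_right u. (D ! j) v \<in> A"
proof -
  let ?n = "of_int \<lfloor>u\<rfloor> :: real"
  have shift: "(D ! j) (v - ?n) = (D ! j) v" for v
    using curves_eq_iff[OF j j] by (simp add: frac_def)
  show "\<forall>\<^sub>F v in at_left u. (D ! j) v \<in> A" if left: "\<forall>\<^sub>F v in at_left (frac u). (D ! j) v \<in> A"
  proof -
    obtain b where b: "b < frac u" "\<And>v. b < v \<Longrightarrow> v < frac u \<Longrightarrow> (D ! j) v \<in> A"
      using left by (auto simp: eventually_at_left_field)
    have "(D ! j) v \<in> A" if "b + ?n < v" "v < u" for v
      using b(2)[of "v - ?n"] that by (simp add: shift frac_def algebra_simps)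
    moreover have "b + ?n < u" using b(1) by (simp add: frac_def)
    ultimately show ?thesis by (auto simp: eventually_at_left_field)
  qed
  show "\<forall>\<^sub>F v in at_right u. (D ! j) v \<in> A" if right: "\<forall>\<^sub>F v in at_right (frac u). (D ! j) v \<in> A"
  proof -
    obtain b where b: "frac u < b" "\<And>v. frac u < v \<Longrightarrow> v < b \<Longrightarrow> (D ! j) v \<in> A"
      using right by (auto simp: eventually_at_right_field)
    have "(D ! j) v \<in> A" if "u < v" "v < b + ?n" for v
      using b(2)[of "v - ?n"] that by (simp add: shift frac_def algebra_simps)
    moreover have "u < b + ?n" using b(1) by (simp add: frac_def)
    ultimately show ?thesis by (auto simp: eventually_at_right_field)
  qed
qed

section \<open>Labels along a component\<close>

text \<open>Let \<open>V y\<close> consist of the parameters around which the curve runs, with the possible exception of the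
  centre, on arcs labelled \<open>y\<close>. These sets are open and pairwise disjoint. They cover the real line:
  at an undercrossing the arcs on the two sides are the incoming and the outgoing arc, which have the
  same label. As the line is connected, only one of them is non-empty.\<close>

lemma arc_labelling_constant:
  assumes j: "j < length D"
    and same: "\<And>i s t. ((i, s), (j, t)) \<in> crossings D \<Longrightarrow>
      c (source_arc D ((i, s), (j, t))) = c (target_arc D ((i, s), (j, t)))"
    and A: "A \<in> arcs_on D j" and A': "A' \<in> arcs_on D j"
  shows "c A = c A'"
proof -
  define V where "V y = {u. \<forall>\<^sub>F v in at u. \<exists>B \<in> arcs_on D j. (D ! j) v \<in> B \<and> c B = y}" for y
  have open_V: "open (V y)" for y
  proof (rule open_subopen[THEN iffD2], rule ballI)
    fix u assume "u \<in> V y"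
    then obtain S where S: "open S" "u \<in> S"
      and good: "\<And>v. v \<in> S \<Longrightarrow> v \<noteq> u \<Longrightarrow> \<exists>B \<in> arcs_on D j. (D ! j) v \<in> B \<and> c B = y"
      by (auto simp: V_def eventually_at_topological)
    have "w \<in> V y" if w: "w \<in> S" for w
    proof (cases "w = u")
      case True
      then show ?thesis using \<open>u \<in> V y\<close> by simp
    next
      case False
      then have "\<forall>\<^sub>F v in at w. v \<in> S - {u}"
        using S w by (intro eventually_at_in_open') auto
      then show ?thesis
        unfolding V_def by (auto elim!: eventually_mono intro!: good)
    qed
    then show "\<exists>T. open T \<and> u \<in> T \<and> T \<subseteq> V y" using S by blast
  qed
  have V_I: "u \<in> V (c B)" if "B \<in> arcs_on D j" "\<forall>\<^sub>F v in at u. (D ! j) v \<in> B" for u B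
    unfolding V_def mem_Collect_eq using that(2) by (rule eventually_mono) (use that(1) in blast)
  have cover: "\<exists>y. u \<in> V y" for u
  proof (cases "(D ! j) u \<in> undercrossing_points D")
    case False
    from arc_at[OF j False] obtain B where "B \<in> arcs_on D j" "\<forall>\<^sub>F v in at u. (D ! j) v \<in> B"
      by blast
    then show ?thesis using V_I by blast
  next
    case True
    then obtain i s t where x: "((i, s), (j, t)) \<in> crossings D" and t: "t = frac u"
      using curves_eq_iff j crossing_bounds unfolding undercrossing_points_def
      by (force simp: frac_eq)
    let ?in = "incoming_arc D ((i, s), (j, t))" and ?out = "outgoing_arc D ((i, s), (j, t))"
    have "c ?in = c ?out"
      using same[OF x] by (auto simp: source_arc_def target_arc_def split: if_splits)
    moreover have "\<forall>\<^sub>F v in at_left u. (D ! j) v \<in> ?in" "\<forall>\<^sub>F v in at_right u. (D ! j) v \<in> ?out"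
      using incoming_arc(2)[OF x] outgoing_arc(2)[OF x] eventually_curve_frac[OF j] unfolding t by blast+
    ultimately have "u \<in> V (c ?in)"
      using incoming_arc(1)[OF x] outgoing_arc(1)[OF x]
      unfolding V_def mem_Collect_eq eventually_at_split
      by (intro conjI; elim eventually_mono) auto
    then show ?thesis ..
  qed
  have disj: "y = y'" if "u \<in> V y" "u \<in> V y'" for u y y'
  proof -
    have "\<forall>\<^sub>F v in at u. (\<exists>B \<in> arcs_on D j. (D ! j) v \<in> B \<and> c B = y)
        \<and> (\<exists>B \<in> arcs_on D j. (D ! j) v \<in> B \<and> c B = y')"
      using that by (auto simp: V_def eventually_conj)
    then obtain v B B' where "B \<in> arcs_on D j" "B' \<in> arcs_on D j" "(D ! j) v \<in> B" "(D ! j) v \<in> B'"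
      "c B = y" "c B' = y'"
      using eventually_happens'[OF at_neq_bot] by blast
    then show ?thesis using arcs_disjoint(2) j by blast
  qed
  have mem: "\<exists>u. u \<in> V (c B)" if B: "B \<in> arcs_on D j" for B
  proof -
    obtain u where u: "(D ! j) u \<in> B" "(D ! j) u \<notin> undercrossing_points D"
      using arc_nonempty[OF B] arc_subset_range[OF B] by blast
    then obtain B' where "B' \<in> arcs_on D j" "(D ! j) u \<in> B'" "\<forall>\<^sub>F v in at u. (D ! j) v \<in> B'"
      using arc_at[OF j] by blast
    moreover then have "B' = B" using arcs_disjoint(2) j B u by blast
    ultimately show ?thesis using V_I by blast
  qed
  obtain u u' where u: "u \<in> V (c A)" "u' \<in> V (c A')" using mem A A' by blast
  show ?thesis
  proof (rule ccontr)
    assume ne: "c A \<noteq> c A'"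
    let ?W = "\<Union>y \<in> - {c A}. V y"
    have "V (c A) \<inter> UNIV = {} \<or> ?W \<inter> UNIV = {}"
    proof (rule connectedD[OF connected_UNIV])
      show "V (c A) \<inter> ?W \<inter> UNIV = {}" using disj by fastforce
      show "UNIV \<subseteq> V (c A) \<union> ?W"
      proof
        fix w :: real
        obtain y where "w \<in> V y" using cover by blast
        then show "w \<in> V (c A) \<union> ?W" by (cases "y = c A") auto
      qed
    qed (use open_V in blast)+
    moreover have "u' \<in> ?W" using u(2) ne by auto
    ultimately show False using u(1) by blast
  qed
qed

end

section \<open>Colorings with a signature and the signature module\<close>

\<comment> \<open>From here on arcs are used through the lemmas above, not through their definite descriptions.\<close>
declare over_arc.simps [simp del] signature_row.simps [simp del]

context diagram
begin

text \<open>The type of an arc as prescribed by the signature. Stating it per arc rather than per component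
  lets the crossing relations mention arcs alone.\<close>

definition arc_type :: "nat list \<Rightarrow> (real^3) set \<Rightarrow> nat" where
  "arc_type \<tau> A = \<tau> ! (THE j. j < length D \<and> A \<in> arcs_on D j)"

lemma arc_type_eq:
  assumes "j < length D" "A \<in> arcs_on D j"
  shows "arc_type \<tau> A = \<tau> ! j"
proof -
  have "(THE j. j < length D \<and> A \<in> arcs_on D j) = j"
  proof (rule the_equality)
    fix i assume "i < length D \<and> A \<in> arcs_on D i"
    then show "i = j" using assms arcs_disjoint(1) arc_nonempty by blast
  qed (use assms in simp)
  then show ?thesis by (simp add: arc_type_def)
qed

lemma crossing_arcs:
  assumes "x \<in> crossings D"
  shows "over_arc D x \<in> arcs D" "source_arc D x \<in> arcs D" "target_arc D x \<in> arcs D"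
proof -
  obtain i s j t where x: "x = ((i, s), (j, t))" by (metis surj_pair)
  have ij: "i < length D" "j < length D" using assms crossing_bounds unfolding x by blast+
  note arcs = assms[unfolded x, THEN over_arc] assms[unfolded x, THEN source_target_arc(1)]
    assms[unfolded x, THEN source_target_arc(2)]
  show "over_arc D x \<in> arcs D" "source_arc D x \<in> arcs D" "target_arc D x \<in> arcs D"
    unfolding x using arcs ij arcs_on_subset_arcs by blast+
qed

lemma arc_type_source_target:
  assumes "x \<in> crossings D"
  shows "arc_type \<tau> (source_arc D x) = arc_type \<tau> (target_arc D x)"
proof -
  obtain i s j t where x: "x = ((i, s), (j, t))" by (metis surj_pair)
  show ?thesis
    using assms source_target_arc arc_type_eq crossing_bounds unfolding x by metis
qed

lemma signature_row_eq:
  assumes "x \<in> crossings D"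
  shows "signature_row D \<tau> x =
    frag_cmul (2 * int (arc_type \<tau> (source_arc D x))) (frag_of (over_arc D x))
    + frag_cmul ((-1) ^ arc_type \<tau> (over_arc D x)) (frag_of (source_arc D x))
    - frag_of (target_arc D x)"
proof -
  obtain i s j t where x: "x = ((i, s), (j, t))" by (metis surj_pair)
  have ij: "i < length D" "j < length D" using assms crossing_bounds unfolding x by blast+
  then have "arc_type \<tau> (source_arc D x) = \<tau> ! j" "arc_type \<tau> (over_arc D x) = \<tau> ! i"
    using assms source_target_arc over_arc unfolding x by (blast intro: arc_type_eq)+
  then show ?thesis by (simp add: x signature_row.simps Let_def)
qed

lemma arc_type_cases:
  assumes "\<tau> \<in> signatures (length D)" "A \<in> arcs D"
  shows "arc_type \<tau> A \<in> {0, 1}"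
proof -
  obtain j where j: "j < length D" "A \<in> arcs_on D j" using assms(2) by (auto simp: arcs_def)
  then have "\<tau> ! j \<in> set \<tau>" using assms(1) by (simp add: signatures_def)
  then show ?thesis
    using assms(1) j unfolding signatures_def by (simp add: arc_type_eq subset_iff)
qed

definition arc_colorings :: "('a, 'm) qnd_scheme \<Rightarrow> ((real^3) set \<Rightarrow> 'a) set" where
  "arc_colorings X = {f \<in> arcs D \<rightarrow>\<^sub>E carrier X. \<forall>x \<in> crossings D.
     f (target_arc D x) = f (source_arc D x) \<rhd>\<^bsub>X\<^esub> f (over_arc D x)}"

text \<open>This is the universal property for the relations of the diagram; their well-formedness is the fact
  that the source, target and over-arc of each crossing are arcs.\<close>

lemma bij_betw_arc_colorings:
  assumes "quandle X"
  shows "bij_betw (\<lambda>h. \<lambda>A \<in> arcs D. h (arc_class D A))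
    (Hom_Qnd (fundamental_quandle D) X) (arc_colorings X)"
proof -
  have R: "quandle_relations D \<subseteq> qterms (arcs D) \<times> qterms (arcs D)"
    using crossing_arcs by (auto simp: quandle_relations_def)
  show ?thesis
    using quandle.bij_betw_Hom_presented[OF assms R]
    by (simp add: fundamental_quandle_def arc_class_def arc_colorings_def quandle_relations_def)
qed

end

locale diagram_group = diagram D + comm_group B for D :: link and B :: "('b, 'm) monoid_scheme" (structure)
begin

lemma signature_colorings_type:
  fixes \<tau> f
  assumes "f = (\<lambda>A \<in> arcs D. h (arc_class D A))"
  shows "(\<forall>j < length D. \<forall>A \<in> arcs_on D j. snd (h (arc_class D A)) = int (\<tau> ! j))
    \<longleftrightarrow> (\<forall>A \<in> arcs D. snd (f A) = int (arc_type \<tau> A))"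
  using assms by (auto simp: arcs_def arc_type_eq)

lemma bij_betw_signature_colorings:
  "bij_betw (\<lambda>h. \<lambda>A \<in> arcs D. h (arc_class D A)) (signature_colorings D B \<tau>)
    {f \<in> arc_colorings (Conj (Dih B)). \<forall>A \<in> arcs D. snd (f A) = int (arc_type \<tau> A)}"
  unfolding signature_colorings_def
  by (intro bij_betw_Collect bij_betw_arc_colorings group.quandle_Conj group_Dih)
     (simp add: signature_colorings_type)

text \<open>Solutions in \<open>B\<close> of the linear system given by the signature matrix, in multiplicative notation
  and solved for the label of the target arc.\<close>

definition module_solutions :: "nat list \<Rightarrow> ((real^3) set \<Rightarrow> 'b) set" where
  "module_solutions \<tau> = {x \<in> arcs D \<rightarrow>\<^sub>E carrier B. \<forall>y \<in> crossings D.
     x (target_arc D y) = x (over_arc D y) [^] (2 * int (arc_type \<tau> (source_arc D y)))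
       \<otimes> x (source_arc D y) [^] ((-1) ^ arc_type \<tau> (over_arc D y) :: int)}"

lemma bij_betw_module_solutions:
  "\<exists>F. bij_betw F (Hom_Z (signature_module D \<tau>) B) (module_solutions \<tau>)"
proof -
  let ?F = "free_Abelian_group (arcs D)"
  interpret F: comm_group ?F by (rule abelian_free_Abelian_group)
  \<comment> \<open>the row in the operations of the free group, so that homomorphisms can be applied to it\<close>
  have row_eq: "signature_row D \<tau> y =
      (frag_of (over_arc D y) [^]\<^bsub>?F\<^esub> (2 * int (arc_type \<tau> (source_arc D y))))
      \<otimes>\<^bsub>?F\<^esub> (frag_of (source_arc D y) [^]\<^bsub>?F\<^esub> ((-1) ^ arc_type \<tau> (over_arc D y) :: int))
      \<otimes>\<^bsub>?F\<^esub> inv\<^bsub>?F\<^esub> (frag_of (target_arc D y))" if "y \<in> crossings D" for y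
    using that crossing_arcs[OF that] by (simp add: signature_row_eq)
  have R: "signature_row D \<tau> ` crossings D \<subseteq> carrier ?F"
  proof (rule image_subsetI)
    fix y assume y: "y \<in> crossings D"
    show "signature_row D \<tau> y \<in> carrier ?F"
      unfolding row_eq[OF y] using crossing_arcs[OF y]
      by (intro F.m_closed F.int_pow_closed F.inv_closed frag_of_in_free_Abelian_group[THEN iffD2])
  qed
  have row: "k (signature_row D \<tau> y) = \<one> \<longleftrightarrow>
      x (target_arc D y) = x (over_arc D y) [^] (2 * int (arc_type \<tau> (source_arc D y)))
       \<otimes> x (source_arc D y) [^] ((-1) ^ arc_type \<tau> (over_arc D y) :: int)"
    if k: "k \<in> hom ?F B" "\<forall>A \<in> arcs D. k (frag_of A) = x A" and y: "y \<in> crossings D" for k x y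
  proof -
    interpret k: group_hom ?F B k using k by unfold_locales auto
    let ?m = "2 * int (arc_type \<tau> (source_arc D y))" and ?n = "(-1) ^ arc_type \<tau> (over_arc D y) :: int"
    note a = crossing_arcs[OF y]
    have c: "frag_of (over_arc D y) \<in> carrier ?F" "frag_of (source_arc D y) \<in> carrier ?F"
      "frag_of (target_arc D y) \<in> carrier ?F" using a by auto
    then have xc: "x (over_arc D y) \<in> carrier B" "x (source_arc D y) \<in> carrier B"
      "x (target_arc D y) \<in> carrier B" using k a k.hom_closed by metis+
    have "k (signature_row D \<tau> y)
        = x (over_arc D y) [^] ?m \<otimes> x (source_arc D y) [^] ?n \<otimes> inv (x (target_arc D y))"
      unfolding row_eq[OF y] using a c k(2)
      by (simp add: k.hom_int_pow del: mult_free_Abelian_group inv_free_Abelian_group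
        int_pow_free_Abelian_group carrier_free_Abelian_group_iff)
    moreover have "\<one> = x (over_arc D y) [^] ?m \<otimes> x (source_arc D y) [^] ?n \<otimes> inv (x (target_arc D y))
        \<longleftrightarrow> x (over_arc D y) [^] ?m \<otimes> x (source_arc D y) [^] ?n = \<one> \<otimes> x (target_arc D y)"
      by (rule inv_solve_right) (use xc in simp_all)
    ultimately show ?thesis using xc(3) by (metis l_one)
  qed
  have "{x \<in> arcs D \<rightarrow>\<^sub>E carrier B. \<exists>k \<in> hom ?F B. (\<forall>A \<in> arcs D. k (frag_of A) = x A)
      \<and> (\<forall>r \<in> signature_row D \<tau> ` crossings D. k r = \<one>)} = module_solutions \<tau>"
  proof (intro equalityI subsetI)
    fix x assume "x \<in> module_solutions \<tau>"
    then have x: "x \<in> arcs D \<rightarrow>\<^sub>E carrier B" and rel: "\<forall>y \<in> crossings D.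
     x (target_arc D y) = x (over_arc D y) [^] (2 * int (arc_type \<tau> (source_arc D y)))
       \<otimes> x (source_arc D y) [^] ((-1) ^ arc_type \<tau> (over_arc D y) :: int)"
      by (simp_all add: module_solutions_def)
    obtain k where "k \<in> hom ?F B" "\<And>A. A \<in> arcs D \<Longrightarrow> k (frag_of A) = x A"
      using free_Abelian_group_universal[of x "arcs D"] x by blast
    then have k: "k \<in> hom ?F B" "\<forall>A \<in> arcs D. k (frag_of A) = x A" by auto
    then show "x \<in> {x \<in> arcs D \<rightarrow>\<^sub>E carrier B. \<exists>k \<in> hom ?F B. (\<forall>A \<in> arcs D. k (frag_of A) = x A)
        \<and> (\<forall>r \<in> signature_row D \<tau> ` crossings D. k r = \<one>)}"
      using x rel row[OF k] by blast
  next
    fix x assume x: "x \<in> {x \<in> arcs D \<rightarrow>\<^sub>E carrier B. \<exists>k \<in> hom ?F B.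
        (\<forall>A \<in> arcs D. k (frag_of A) = x A) \<and> (\<forall>r \<in> signature_row D \<tau> ` crossings D. k r = \<one>)}"
    then obtain k where k: "k \<in> hom ?F B" "\<forall>A \<in> arcs D. k (frag_of A) = x A"
      and rows: "\<And>y. y \<in> crossings D \<Longrightarrow> k (signature_row D \<tau> y) = \<one>"
      by blast
    show "x \<in> module_solutions \<tau>"
      unfolding module_solutions_def using x rows row[OF k] by blast
  qed
  then show ?thesis
    using bij_betw_Hom_free_quotient[OF R] by (auto simp: signature_module_def Let_def)
qed

text \<open>With the types fixed, applying \<open>twist\<close> arc by arc is an involution on the \<open>B\<close>-parts, and by
  \<open>rhd_Conj_Dih\<close> it turns the linear relation at a crossing into the conjugation relation.\<close>

lemma bij_betw_twist:
  assumes \<tau>: "\<tau> \<in> signatures (length D)"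
  shows "bij_betw (\<lambda>x. \<lambda>A \<in> arcs D. (twist (arc_type \<tau> A) (x A), int (arc_type \<tau> A)))
    (module_solutions \<tau>)
    {f \<in> arc_colorings (Conj (Dih B)). \<forall>A \<in> arcs D. snd (f A) = int (arc_type \<tau> A)}"
    (is "bij_betw ?\<Phi> ?M ?C")
proof (rule bij_betw_byWitness[where f' = "\<lambda>f. \<lambda>A \<in> arcs D. twist (arc_type \<tau> A) (fst (f A))"])
  have rel: "?\<Phi> x (target_arc D y) = ?\<Phi> x (source_arc D y) \<rhd>\<^bsub>Conj (Dih B)\<^esub> ?\<Phi> x (over_arc D y) \<longleftrightarrow>
     x (target_arc D y) = x (over_arc D y) [^] (2 * int (arc_type \<tau> (source_arc D y)))
       \<otimes> x (source_arc D y) [^] ((-1) ^ arc_type \<tau> (over_arc D y) :: int)"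
    if x: "x \<in> arcs D \<rightarrow> carrier B" and y: "y \<in> crossings D" for x y
  proof -
    note a = crossing_arcs[OF y]
    have xc: "x (over_arc D y) \<in> carrier B" "x (source_arc D y) \<in> carrier B"
      "x (target_arc D y) \<in> carrier B" using a x by auto
    have tw: "twist e b = twist e b' \<longleftrightarrow> b = b'" if "b \<in> carrier B" "b' \<in> carrier B" for b b' e
      using that by (metis twist_twist)
    show ?thesis
      using a xc arc_type_cases[OF \<tau>] arc_type_source_target[OF y, of \<tau>]
      by (simp add: rhd_Conj_Dih tw)
  qed
  have carr: "carrier (Conj (Dih B)) = carrier B \<times> {0, 1}" by (simp add: Conj_def carrier_Dih)
  show "\<forall>x \<in> ?M. (\<lambda>A \<in> arcs D. twist (arc_type \<tau> A) (fst (?\<Phi> x A))) = x"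
    by (auto simp: module_solutions_def fun_eq_iff PiE_def Pi_def extensional_def)
  show inv: "\<forall>f \<in> ?C. ?\<Phi> (\<lambda>A \<in> arcs D. twist (arc_type \<tau> A) (fst (f A))) = f"
  proof (intro ballI ext)
    fix f A assume f: "f \<in> ?C"
    show "?\<Phi> (\<lambda>A \<in> arcs D. twist (arc_type \<tau> A) (fst (f A))) A = f A"
    proof (cases "A \<in> arcs D")
      case True
      then have "f A \<in> carrier B \<times> {0, 1}" "snd (f A) = int (arc_type \<tau> A)"
        using f by (auto simp: arc_colorings_def carr)
      then show ?thesis using True by (auto simp: prod_eq_iff)
    qed (use f in \<open>auto simp: arc_colorings_def\<close>)
  qed
  show "?\<Phi> ` ?M \<subseteq> ?C"
  proof (rule image_subsetI)
    fix x assume "x \<in> ?M"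
    then show "?\<Phi> x \<in> ?C"
      using rel[of x] arc_type_cases[OF \<tau>]
      by (auto simp: module_solutions_def arc_colorings_def carr PiE_def Pi_def)
  qed
  show "(\<lambda>f. \<lambda>A \<in> arcs D. twist (arc_type \<tau> A) (fst (f A))) ` ?C \<subseteq> ?M"
  proof (rule image_subsetI)
    fix f assume f: "f \<in> ?C"
    let ?x = "\<lambda>A \<in> arcs D. twist (arc_type \<tau> A) (fst (f A))"
    have x: "?x \<in> arcs D \<rightarrow>\<^sub>E carrier B"
      using f by (auto simp: arc_colorings_def carr PiE_def Pi_def mem_Times_iff)
    have \<Phi>x: "?\<Phi> ?x = f" using inv f by blast
    have "?x (target_arc D y) = ?x (over_arc D y) [^] (2 * int (arc_type \<tau> (source_arc D y)))
       \<otimes> ?x (source_arc D y) [^] ((-1) ^ arc_type \<tau> (over_arc D y) :: int)"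
      if y: "y \<in> crossings D" for y
    proof (rule rel[THEN iffD1, OF _ y])
      show "?x \<in> arcs D \<rightarrow> carrier B" by (rule IntD1[OF x[unfolded PiE_def]])
      show "?\<Phi> ?x (target_arc D y)
          = ?\<Phi> ?x (source_arc D y) \<rhd>\<^bsub>Conj (Dih B)\<^esub> ?\<Phi> ?x (over_arc D y)"
        unfolding \<Phi>x using f y by (simp add: arc_colorings_def)
    qed
    then show "?x \<in> ?M" using x unfolding module_solutions_def by blast
  qed
qed

lemma bij_betw_signature_colorings_Hom_Z:
  assumes "\<tau> \<in> signatures (length D)"
  shows "\<exists>F. bij_betw F (signature_colorings D B \<tau>) (Hom_Z (signature_module D \<tau>) B)"
proof -
  obtain F where "bij_betw F (Hom_Z (signature_module D \<tau>) B) (module_solutions \<tau>)"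
    using bij_betw_module_solutions by blast
  from bij_betw_trans[OF bij_betw_trans[OF this bij_betw_twist[OF assms]]
      bij_betw_inv_into[OF bij_betw_signature_colorings]]
  show ?thesis using bij_betw_inv_into by blast
qed

text \<open>\<open>Conj (Dih B)\<close> preserves the type of its left operand, so source and target have equal types.\<close>

lemma coloring_type_constant:
  assumes f: "f \<in> arc_colorings (Conj (Dih B))"
    and j: "j < length D" "A \<in> arcs_on D j" "A' \<in> arcs_on D j"
  shows "snd (f A) = snd (f A')"
proof (rule arc_labelling_constant[OF j(1) _ j(2,3), where c = "\<lambda>A. snd (f A)"])
  fix i s t assume x: "((i, s), (j, t)) \<in> crossings D"
  show "snd (f (source_arc D ((i, s), (j, t)))) = snd (f (target_arc D ((i, s), (j, t))))"
    using f x crossing_arcs[OF x] snd_rhd_Conj_Dih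
    by (auto simp: arc_colorings_def Conj_def PiE_def Pi_def)
qed

text \<open>The signature can be read off from any one arc on each component, as the type is constant there.\<close>

lemma coloring_has_signature:
  assumes h: "h \<in> Hom_Qnd (fundamental_quandle D) (Conj (Dih B))"
  shows "\<exists>\<tau> \<in> signatures (length D). h \<in> signature_colorings D B \<tau>"
proof -
  let ?f = "\<lambda>A \<in> arcs D. h (arc_class D A)"
  have f: "?f \<in> arc_colorings (Conj (Dih B))"
    using bij_betw_apply[OF bij_betw_arc_colorings[OF group.quandle_Conj[OF group_Dih]] h] .
  define \<tau> where "\<tau> = map (\<lambda>j. nat (snd (?f (SOME A. A \<in> arcs_on D j)))) [0..<length D]"
  have snd_f: "snd (?f A) \<in> {0, 1}" if "A \<in> arcs D" for A
    using f that by (auto simp: arc_colorings_def Conj_def carrier_Dih PiE_def Pi_def mem_Times_iff)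
  have some: "(SOME A. A \<in> arcs_on D j) \<in> arcs_on D j" if "j < length D" for j
    using arcs_on_nonempty[OF that] by (simp add: some_in_eq)
  have "\<tau> \<in> signatures (length D)"
    using snd_f some arcs_on_subset_arcs by (fastforce simp: signatures_def \<tau>_def simp del: restrict_apply)
  moreover have "snd (h (arc_class D A)) = int (\<tau> ! j)" if j: "j < length D" "A \<in> arcs_on D j" for j A
  proof -
    have "A \<in> arcs D" using arcs_on_subset_arcs j by blast
    then have "snd (h (arc_class D A)) = snd (?f A)" by simp
    also have "\<dots> = snd (?f (SOME A. A \<in> arcs_on D j))"
      by (rule coloring_type_constant[OF f j some[OF j(1)]])
    also have "\<dots> = int (\<tau> ! j)"
      using snd_f[OF arcs_on_subset_arcs[OF j(1), THEN subsetD, OF some[OF j(1)]]] j(1)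
      by (auto simp: \<tau>_def simp del: restrict_apply)
    finally show ?thesis .
  qed
  ultimately show ?thesis using h by (auto simp: signature_colorings_def)
qed

lemma signature_unique:
  assumes "\<tau> \<in> signatures (length D)" "\<tau>' \<in> signatures (length D)"
    "h \<in> signature_colorings D B \<tau>" "h \<in> signature_colorings D B \<tau>'"
  shows "\<tau> = \<tau>'"
proof (rule nth_equalityI)
  fix j assume "j < length \<tau>"
  then have j: "j < length D" using assms(1) by (simp add: signatures_def)
  then obtain A where "A \<in> arcs_on D j" using arcs_on_nonempty by blast
  then show "\<tau> ! j = \<tau>' ! j" using assms(3,4) j by (force simp: signature_colorings_def)
qed (use assms in \<open>simp add: signatures_def\<close>)

end

section \<open>The bijections\<close>

lemma bij_betw_Sigma_of_disjoint:
  assumes "\<And>i. i \<in> I \<Longrightarrow> \<exists>F. bij_betw F (C i) (H i)"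
    and C: "\<And>c. c \<in> A \<longleftrightarrow> (\<exists>i \<in> I. c \<in> C i)"
    and disj: "\<And>c i j. \<lbrakk>i \<in> I; j \<in> I; c \<in> C i; c \<in> C j\<rbrakk> \<Longrightarrow> i = j"
  shows "\<exists>F. bij_betw F A (SIGMA i:I. H i)"
proof -
  obtain F where F: "\<And>i. i \<in> I \<Longrightarrow> bij_betw (F i) (C i) (H i)"
    using assms(1) by metis
  define ix where "ix c = (SOME i. i \<in> I \<and> c \<in> C i)" for c
  have ix: "ix c \<in> I" "c \<in> C (ix c)" if "c \<in> A" for c
    using that C someI_ex[of "\<lambda>i. i \<in> I \<and> c \<in> C i"] unfolding ix_def by blast+
  have "bij_betw (\<lambda>c. (ix c, F (ix c) c)) A (SIGMA i:I. H i)"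
  proof (rule bij_betw_imageI)
    show "inj_on (\<lambda>c. (ix c, F (ix c) c)) A"
      by (rule inj_onI) (metis F Pair_inject bij_betw_imp_inj_on inj_onD ix)
    show "(\<lambda>c. (ix c, F (ix c) c)) ` A = (SIGMA i:I. H i)"
    proof (intro equalityI subsetI)
      fix p assume "p \<in> (SIGMA i:I. H i)"
      then obtain i y where p: "p = (i, y)" "i \<in> I" "y \<in> H i" by blast
      then obtain c where c: "c \<in> C i" "F i c = y"
        using F by (metis bij_betw_imp_surj_on imageE)
      then have "c \<in> A" "ix c = i" using C ix disj p by blast+
      then show "p \<in> (\<lambda>c. (ix c, F (ix c) c)) ` A" using c p by force
    qed (use bij_betw_apply[OF F] ix in auto)
  qed
  then show ?thesis by blast
qed

theorem theorem10p1:
  fixes L D :: link and B :: "('b, 'm) monoid_scheme"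
  assumes "oriented_link L" and "diagram_of D L" and "comm_group B"
  shows "(\<forall>\<tau> \<in> signatures (length L).
            \<exists>F. bij_betw F (signature_colorings D B \<tau>) (Hom_Z (signature_module D \<tau>) B))
       \<and> (\<exists>F. bij_betw F (Hom_Qnd (fundamental_quandle D) (Conj (Dih B)))
                (SIGMA \<tau>:signatures (length L). Hom_Z (signature_module D \<tau>) B))"
proof -
  have len: "length L = length D" and "link_diagram D"
    using assms(2) by (auto simp: diagram_of_def ambient_isotopic_def)
  then interpret diagram_group D B
    using assms(3) by (simp add: diagram_group_def diagram_def)
  have "\<exists>F. bij_betw F (Hom_Qnd (fundamental_quandle D) (Conj (Dih B)))
      (SIGMA \<tau>:signatures (length D). Hom_Z (signature_module D \<tau>) B)"
  proof (rule bij_betw_Sigma_of_disjoint[where C = "signature_colorings D B"])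
    show "h \<in> Hom_Qnd (fundamental_quandle D) (Conj (Dih B)) \<longleftrightarrow>
        (\<exists>\<tau> \<in> signatures (length D). h \<in> signature_colorings D B \<tau>)" for h
      using coloring_has_signature by (auto simp: signature_colorings_def)
  qed (use bij_betw_signature_colorings_Hom_Z signature_unique in blast)+
  then show ?thesis using bij_betw_signature_colorings_Hom_Z by (simp add: len)
qed

end
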